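(* Let $\mathcal{H}$ be a real or complex Hilbert space, let $\mathcal{W}=\{(W_i,v_i)\}_{i\in I}$ be a fusion frame for $\mathcal{H}$, and let $\{w_i\}_{i\in I}\in\mathcal{P}(\mathcal{W})$ be equivalent to $\{v_i\}_{i\in I}$. Then $\mathcal{V}=\{(W_i,w_i)\}_{i\in I}$ is a fusion frame for $\mathcal{H}$ and $e(\mathcal{W})=e(\mathcal{V})$.
   Context: A fusion frame for $\mathcal{H}$ is a countable family $\{(W_i,v_i)\}_{i\in I}$ of closed subspaces $W_i\subseteq\mathcal{H}$ with weights $v_i>0$ for which there are constants $0<A\le B<\infty$ with $A\|x\|^2\le\sum_{i\in I}v_i^2\|P_{W_i}(x)\|^2\le B\|x\|^2$ for all $x\in\mathcal{H}$, where $P_{W_i}$ is the orthogonal projection onto $W_i$. Weight families are assumed to lie in $\ell^\infty_+(I)$ (bounded families of positive numbers). For a family $\{W_i\}_{i\in I}$ of closed subspaces with $\overline{\operatorname{span}}\{W_i: i\in I\}=\mathcal{H}$, $\mathcal{P}(\mathcal{W})$ denotes the set of weights $\{w_i\}_{i\in I}\in\ell^\infty_+(I)$ such that $\{(W_i,w_i)\}_{i\in I}$ is a fusion frame for $\mathcal{H}$. Two weights $v,w\in\mathcal{P}(\mathcal{W})$ are equivalent if there is $\alpha>0$ with $v=\alpha w$. The synthesis operator of $\mathcal{W}=\{(W_i,v_i)\}_{i\in I}$ is $T_{\mathcal{W}}:\big(\sum_{i\in I}\oplus W_i\big)_{\ell_2}\to\mathcal{H}$, $T_{\mathcal{W}}(\{f_i\}_{i\in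 I})=\sum_{i\in I}v_if_i$, where $\big(\sum_{i\in I}\oplus W_i\big)_{\ell_2}$ is the Hilbert space of families $\{f_i\}_{i\in I}$ with $f_i\in W_i$ and $\sum_i\|f_i\|^2<\infty$. The excess of $\mathcal{W}$ is $e(\mathcal{W})=\dim\ker T_{\mathcal{W}}$. *)

theory Defs
  imports "HOL-Analysis.Analysis"
begin

unbundle cardinal_syntax

text \<open>
  The scalar field is \<open>\<real>\<close> or \<open>\<complex>\<close>. The class below treats the two uniformly: the norm of a
  \<open>real_normed_field\<close> is multiplicative, so by the Gelfand--Mazur theorem every instance is
  isometrically isomorphic to \<open>\<real>\<close> or \<open>\<complex>\<close>, and the last axiom forces
  \<open>conj z = (norm z)\<^sup>2 / z\<close>, the usual conjugation.
\<close>

class real_or_complex = real_normed_field + banach +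
  fixes conj :: "'a \<Rightarrow> 'a"
  assumes conj_add: "conj (x + y) = conj x + conj y"
    and conj_mult: "conj (x * y) = conj x * conj y"
    and conj_conj: "conj (conj x) = x"
    and mult_conj: "x * conj x = (norm x)\<^sup>2 *\<^sub>R 1"

instantiation real :: real_or_complex
begin
definition conj_real :: "real \<Rightarrow> real" where "conj_real x = x"
instance
  by standard (simp_all add: conj_real_def power2_eq_square)
end

instantiation complex :: real_or_complex
begin
definition conj_complex :: "complex \<Rightarrow> complex" where "conj_complex z = cnj z"
instance proof
  fix z :: complex
  show "z * conj z = (norm z)\<^sup>2 *\<^sub>R 1"
    unfolding conj_complex_def scaleR_conv_of_real mult_1_right by (rule complex_norm_square[symmetric])
qed (simp_all add: conj_complex_def)
end

text \<open>
  Completeness and the topology come from the class \<open>banach\<close>; the locale says that the norm is the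
  one induced by \<open>ip\<close> and that \<open>smul\<close> extends the real scalar multiplication of \<open>'h\<close>.
\<close>

locale hilbert_space = vector_space smul
  for smul :: "'k::real_or_complex \<Rightarrow> 'h::banach \<Rightarrow> 'h" +
  fixes ip :: "'h \<Rightarrow> 'h \<Rightarrow> 'k"
  assumes scale_of_real: "smul (of_real r) x = r *\<^sub>R x"
    and ip_add_left: "ip (x + y) z = ip x z + ip y z"
    and ip_scale_left: "ip (smul c x) z = c * ip x z"
    and ip_commute: "ip y x = conj (ip x y)"
    and ip_self: "ip x x = of_real ((norm x)\<^sup>2)"

lemma hilbert_space_real:
  "hilbert_space scaleR (inner :: 'h::{real_inner,banach} \<Rightarrow> 'h \<Rightarrow> real)"
proof unfold_locales
  fix x y :: 'h
  show "inner y x = conj (inner x y)" by (simp add: conj_real_def inner_commute)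
qed (simp_all add: inner_add_left power2_norm_eq_inner scaleR_add_right scaleR_add_left)

lemma hilbert_space_scalars:
  "hilbert_space (*) (\<lambda>x y :: 'k::real_or_complex. x * conj y)"
proof unfold_locales
  fix x y :: 'k and r :: real
  show "of_real r * x = r *\<^sub>R x" by (simp only: scaleR_conv_of_real)
  show "y * conj x = conj (x * conj y)" by (simp only: conj_mult conj_conj mult.commute)
  show "x * conj x = of_real ((norm x)\<^sup>2)" by (simp only: mult_conj of_real_def)
qed (simp_all only: distrib_left distrib_right mult.assoc mult_1_left)

definition closed_subspace ::
  "('k::real_or_complex \<Rightarrow> 'h::banach \<Rightarrow> 'h) \<Rightarrow> 'h set \<Rightarrow> bool"
  where "closed_subspace smul S \<longleftrightarrow> module.subspace smul S \<and> closed S"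

definition orth_proj ::
  "('h \<Rightarrow> 'h \<Rightarrow> 'k::real_or_complex) \<Rightarrow> 'h::banach set \<Rightarrow> 'h \<Rightarrow> 'h"
  where "orth_proj ip S x = (THE p. p \<in> S \<and> (\<forall>y\<in>S. ip (x - p) y = 0))"

text \<open>
  \<open>\<ell>\<^sup>\<infinity>\<^sub>+(I)\<close>; only the values on \<open>I\<close> matter.
\<close>

definition pos_bounded_weights :: "'i set \<Rightarrow> ('i \<Rightarrow> real) set"
  where "pos_bounded_weights I = {v. (\<forall>i\<in>I. v i > 0) \<and> bdd_above (v ` I)}"

definition fusion_frame ::
  "('k::real_or_complex \<Rightarrow> 'h::banach \<Rightarrow> 'h) \<Rightarrow> ('h \<Rightarrow> 'h \<Rightarrow> 'k)
    \<Rightarrow> 'i set \<Rightarrow> ('i \<Rightarrow> 'h set) \<Rightarrow> ('i \<Rightarrow> real) \<Rightarrow> bool"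
  where "fusion_frame smul ip I W v \<longleftrightarrow>
    countable I \<and> (\<forall>i\<in>I. closed_subspace smul (W i)) \<and> v \<in> pos_bounded_weights I \<and>
    (\<exists>A B. 0 < A \<and> A \<le> B \<and>
      (\<forall>x. (\<lambda>i. (v i)\<^sup>2 * (norm (orth_proj ip (W i) x))\<^sup>2) summable_on I \<and>
        A * (norm x)\<^sup>2 \<le> (\<Sum>\<^sub>\<infinity>i\<in>I. (v i)\<^sup>2 * (norm (orth_proj ip (W i) x))\<^sup>2) \<and>
        (\<Sum>\<^sub>\<infinity>i\<in>I. (v i)\<^sup>2 * (norm (orth_proj ip (W i) x))\<^sup>2) \<le> B * (norm x)\<^sup>2))"

text \<open>
  The set \<open>\<P>(\<W>)\<close>. The condition that the \<open>W i\<close> span a dense subspace is not repeated: the lower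
  frame bound forces it, since a vector orthogonal to every \<open>W i\<close> has all projections zero.
\<close>

definition admissible_weights ::
  "('k::real_or_complex \<Rightarrow> 'h::banach \<Rightarrow> 'h) \<Rightarrow> ('h \<Rightarrow> 'h \<Rightarrow> 'k)
    \<Rightarrow> 'i set \<Rightarrow> ('i \<Rightarrow> 'h set) \<Rightarrow> ('i \<Rightarrow> real) set"
  where "admissible_weights smul ip I W =
    {w \<in> pos_bounded_weights I. fusion_frame smul ip I W w}"

definition equivalent_weights :: "'i set \<Rightarrow> ('i \<Rightarrow> real) \<Rightarrow> ('i \<Rightarrow> real) \<Rightarrow> bool"
  where "equivalent_weights I v w \<longleftrightarrow> (\<exists>\<alpha>>0. \<forall>i\<in>I. v i = \<alpha> * w i)"

text \<open>
  The \<open>\<ell>\<^sup>2\<close>-sum of the \<open>W i\<close>. Families indexed by \<open>I\<close> are functions on the whole index type that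
  vanish outside \<open>I\<close>, so that equality of families is equality of functions.
\<close>

definition l2_sum :: "'i set \<Rightarrow> ('i \<Rightarrow> 'h::banach set) \<Rightarrow> ('i \<Rightarrow> 'h) set"
  where "l2_sum I W = {f. (\<forall>i\<in>I. f i \<in> W i) \<and> (\<forall>i. i \<notin> I \<longrightarrow> f i = 0) \<and>
    (\<lambda>i. (norm (f i))\<^sup>2) summable_on I}"

definition l2_ip ::
  "('h::banach \<Rightarrow> 'h \<Rightarrow> 'k::real_or_complex) \<Rightarrow> 'i set \<Rightarrow> ('i \<Rightarrow> 'h) \<Rightarrow> ('i \<Rightarrow> 'h) \<Rightarrow> 'k"
  where "l2_ip ip I f g = (\<Sum>\<^sub>\<infinity>i\<in>I. ip (f i) (g i))"

text \<open>
  For a fusion frame the upper frame bound makes this sum converge unconditionally on all of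
  \<open>l2_sum I W\<close>, so the default value of \<open>infsum\<close> plays no role.
\<close>

definition synthesis_op :: "'i set \<Rightarrow> ('i \<Rightarrow> real) \<Rightarrow> ('i \<Rightarrow> 'h::banach) \<Rightarrow> 'h"
  where "synthesis_op I v f = (\<Sum>\<^sub>\<infinity>i\<in>I. v i *\<^sub>R f i)"

definition synthesis_kernel ::
  "'i set \<Rightarrow> ('i \<Rightarrow> 'h::banach set) \<Rightarrow> ('i \<Rightarrow> real) \<Rightarrow> ('i \<Rightarrow> 'h) set"
  where "synthesis_kernel I W v = {f \<in> l2_sum I W. synthesis_op I v f = 0}"

text \<open>
  The dimension of a Hilbert space is the cardinality of any of its orthonormal bases, that is,
  of its maximal orthonormal subsets. It is represented by the cardinal of a chosen basis, so
  dimensions are to be compared with \<open>=o\<close>.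
\<close>

definition orthonormal_set :: "('v \<Rightarrow> 'v \<Rightarrow> 'k::real_or_complex) \<Rightarrow> 'v set \<Rightarrow> bool"
  where "orthonormal_set ip B \<longleftrightarrow> (\<forall>b\<in>B. \<forall>c\<in>B. ip b c = (if b = c then 1 else 0))"

definition orthonormal_basis ::
  "('v \<Rightarrow> 'v \<Rightarrow> 'k::real_or_complex) \<Rightarrow> 'v set \<Rightarrow> 'v set \<Rightarrow> bool"
  where "orthonormal_basis ip K B \<longleftrightarrow> B \<subseteq> K \<and> orthonormal_set ip B \<and>
    (\<forall>C. B \<subseteq> C \<and> C \<subseteq> K \<and> orthonormal_set ip C \<longrightarrow> C = B)"

lemma orthonormal_basis_exists: "\<exists>B. orthonormal_basis ip K B"
proof -
  let ?\<A> = "{B. B \<subseteq> K \<and> orthonormal_set ip B}"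
  have "\<exists>M\<in>?\<A>. \<forall>X\<in>?\<A>. M \<subseteq> X \<longrightarrow> X = M"
  proof (rule subset_Zorn')
    fix \<C> assume c: "subset.chain ?\<A> \<C>"
    have "orthonormal_set ip (\<Union>\<C>)"
      unfolding orthonormal_set_def
    proof (intro ballI)
      fix b d assume "b \<in> \<Union>\<C>" "d \<in> \<Union>\<C>"
      then obtain X Y where X: "X \<in> \<C>" "b \<in> X" and Y: "Y \<in> \<C>" "d \<in> Y" by blast
      have "X \<subseteq> Y \<or> Y \<subseteq> X" using c X Y by (auto simp: subset_chain_def)
      then obtain Z where "Z \<in> \<C>" "b \<in> Z" "d \<in> Z" using X Y by (metis subsetD)
      moreover have "\<C> \<subseteq> ?\<A>" using c by (simp add: subset_chain_def)
      ultimately have "orthonormal_set ip Z" "b \<in> Z" "d \<in> Z" by auto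
      then show "ip b d = (if b = d then 1 else 0)"
        by (simp add: orthonormal_set_def)
    qed
    moreover have "\<Union>\<C> \<subseteq> K" using c by (auto simp: subset_chain_def)
    ultimately show "\<Union>\<C> \<in> ?\<A>" by simp
  qed
  then obtain M where "M \<in> ?\<A>" and max: "\<forall>X\<in>?\<A>. M \<subseteq> X \<longrightarrow> X = M" ..
  then have "orthonormal_basis ip K M" by (simp add: orthonormal_basis_def)
  then show ?thesis ..
qed

definition hilbert_dim :: "('v \<Rightarrow> 'v \<Rightarrow> 'k::real_or_complex) \<Rightarrow> 'v set \<Rightarrow> 'v rel"
  where "hilbert_dim ip K = |SOME B. orthonormal_basis ip K B|"

definition excess ::
  "('h::banach \<Rightarrow> 'h \<Rightarrow> 'k::real_or_complex)
    \<Rightarrow> 'i set \<Rightarrow> ('i \<Rightarrow> 'h set) \<Rightarrow> ('i \<Rightarrow> real) \<Rightarrow> ('i \<Rightarrow> 'h) rel"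
  where "excess ip I W v = hilbert_dim (l2_ip ip I) (synthesis_kernel I W v)"

end

theory Submission
  imports Defs
begin

text \<open>If \<open>w = \<alpha> v\<close> on \<open>I\<close> with \<alpha> > 0, the synthesis
  operators differ by the nonzero factor \<alpha> on the same l2-sum, so they have the same kernel
  (\<open>synthesis_kernel_equivalent_weights\<close>) and hence the same excess. The frame property
  of \<open>w\<close> is part of admissibility.\<close>

lemma synthesis_op_scale_weights:
  assumes "\<And>i. i \<in> I \<Longrightarrow> w i = \<alpha> * v i"
  shows "synthesis_op I w f = \<alpha> *\<^sub>R synthesis_op I v f"
proof -
  have "synthesis_op I w f = (\<Sum>\<^sub>\<infinity>i\<in>I. \<alpha> *\<^sub>R (v i *\<^sub>R f i))"
    unfolding synthesis_op_def by (rule infsum_cong) (simp add: assms)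
  \<comment> \<open>Needs no summability: for nonzero \<alpha> both sums converge or both default to
    0, and for \<alpha> = 0 both sides vanish.\<close>
  also have "\<dots> = \<alpha> *\<^sub>R synthesis_op I v f"
    unfolding synthesis_op_def by (rule infsum_scaleR_right)
  finally show ?thesis .
qed

text \<open>The domain \<open>l2_sum I W\<close> does not involve the weights, and scaling by
  \<alpha> > 0 preserves the zeros of the synthesis operator.\<close>

lemma synthesis_kernel_equivalent_weights:
  assumes "equivalent_weights I w v"
  shows "synthesis_kernel I W w = synthesis_kernel I W v"
proof -
  obtain \<alpha> where "\<alpha> > 0" and "\<And>i. i \<in> I \<Longrightarrow> w i = \<alpha> * v i"
    using assms by (auto simp: equivalent_weights_def)
  then show ?thesis
    by (simp add: synthesis_kernel_def synthesis_op_scale_weights[of I w \<alpha> v])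
qed

theorem proposition5p5:
  fixes smul :: "'k::real_or_complex \<Rightarrow> 'h::banach \<Rightarrow> 'h"
    and ip :: "'h \<Rightarrow> 'h \<Rightarrow> 'k"
    and I :: "'i set"
    and W :: "'i \<Rightarrow> 'h set"
    and v w :: "'i \<Rightarrow> real"
  assumes "hilbert_space smul ip"
    and "fusion_frame smul ip I W v"
    and "w \<in> admissible_weights smul ip I W"
    and "equivalent_weights I w v"
  shows "fusion_frame smul ip I W w \<and> excess ip I W v =o excess ip I W w"
proof
  show "fusion_frame smul ip I W w"
    using assms(3) by (simp add: admissible_weights_def)
  show "excess ip I W v =o excess ip I W w"
    \<comment> \<open>With equal kernels, \<open>SOME\<close> picks the same basis on both sides, so
      no comparison of different orthonormal bases arises.\<close>
    unfolding excess_def synthesis_kernel_equivalent_weights[OF assms(4)] hilbert_dim_def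
    by (rule card_of_refl)
qed

end
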